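(* Let $\mathcal{E}(t,u)$ be the exact flow of the evolution equation $\frac{\mathrm{d}}{\mathrm{d}t}u(t)=F(u(t))$ on $X$, let $\mathcal{S}(t,u)$, $|t|<T$, be the flow of a consistent one-step scheme for this equation (not necessarily self-adjoint), let $\mathcal{L}(t,u)=\mathcal{S}(t,u)-\mathcal{E}(t,u)$ be its local error, and let $$\mathcal{D}_{s}(t,u)=\partial_1\mathcal{S}(t,u)-\tfrac12\big(F(\mathcal{S}(t,u))+\partial_2\mathcal{S}(t,u)\cdot F(u)\big)$$ be its symmetrized defect. Then for every $u_0\in X$ and every $t$ with $|t|<T$, $$\mathcal{L}(t,u_0)=\int_0^t \partial_2\mathcal{E}\big(\tfrac{t-s}{2},\,\mathcal{S}(s,\mathcal{E}(\tfrac{t-s}{2},u_0))\big)\cdot \mathcal{D}_{s}\big(s,\mathcal{E}(\tfrac{t-s}{2},u_0)\big)\,\mathrm{d}s .$$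
   Context: Setting: $X$ is a real Banach space (e.g. $\mathbb{R}^d$), and $F:X\to X$ is smooth ($C^\infty$) and bounded with bounded derivatives. The exact flow $\mathcal{E}:\mathbb{R}\times X\to X$ is defined by $\partial_1\mathcal{E}(t,u)=F(\mathcal{E}(t,u))$, $\mathcal{E}(0,u)=u$. Here $\partial_1$ and $\partial_2$ denote the derivatives with respect to the first argument (time) and the second argument (initial value); $\partial_2\mathcal{E}(t,u)$ and $\partial_2\mathcal{S}(t,u)$ are bounded linear operators on $X$, and $\cdot$ denotes application of such an operator to a vector. The flow of a one-step scheme is a smooth map $\mathcal{S}:(-T,T)\times X\to X$ (for some $T>0$) with $\mathcal{S}(0,u)=u$ for all $u$; the first argument is the stepsize. It is assumed to have some order $p\ge 1$, i.e. $\mathcal{L}(t,u)=\mathcal{O}(t^{p+1})$ as $t\to0$ for every $u\in X$. The subscript in $\mathcal{D}_{s}$ stands for "symmetrized" and is unrelated to the integration variable $s$. *)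

theory Defs
  imports "HOL-Analysis.Analysis" "HOL-Library.Landau_Symbols"
begin

text \<open>
  The k-th derivative of a map at a point is a bounded k-linear map, represented as a function on
  argument lists of length k; its values on lists of any other length are irrelevant.
\<close>

definition bounded_multilinear ::
    "nat \<Rightarrow> ('a::real_normed_vector list \<Rightarrow> 'b::real_normed_vector) \<Rightarrow> bool" where
  "bounded_multilinear k M \<longleftrightarrow>
     (\<forall>vs i. length vs = k \<longrightarrow> i < k \<longrightarrow> linear (\<lambda>v. M (vs[i := v]))) \<and>
     (\<exists>K. \<forall>vs. length vs = k \<longrightarrow> norm (M vs) \<le> K * (\<Prod>v\<leftarrow>vs. norm v))"

text \<open>
  \<open>D x\<close>, restricted to lists of length k, is the k-th Frechet derivative of \<open>f\<close> at \<open>x\<close>. The last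
  clause says that the (k+1)-st derivative is the Frechet derivative of the k-th one with respect
  to the operator norm on bounded k-linear maps (the increment \<open>y - x\<close> is the first argument).
\<close>

definition iterated_derivatives ::
    "'a::real_normed_vector set \<Rightarrow> ('a \<Rightarrow> 'b::real_normed_vector) \<Rightarrow> ('a \<Rightarrow> 'a list \<Rightarrow> 'b) \<Rightarrow> bool"
  where
  "iterated_derivatives U f D \<longleftrightarrow>
     (\<forall>x\<in>U. D x [] = f x \<and>
       (\<forall>k. bounded_multilinear k (D x) \<and>
         (\<forall>e>0. \<forall>\<^sub>F y in at x. \<forall>vs. length vs = k \<longrightarrow>
            norm (D y vs - D x vs - D x ((y - x) # vs))
              \<le> e * norm (y - x) * (\<Prod>v\<leftarrow>vs. norm v))))"

definition smooth_on ::
    "'a::real_normed_vector set \<Rightarrow> ('a \<Rightarrow> 'b::real_normed_vector) \<Rightarrow> bool" where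
  "smooth_on U f \<longleftrightarrow> open U \<and> (\<exists>D. iterated_derivatives U f D)"

text \<open>The case k = 0 below is boundedness of the map itself.\<close>

definition smooth_with_bounded_derivatives ::
    "('a::real_normed_vector \<Rightarrow> 'b::real_normed_vector) \<Rightarrow> bool" where
  "smooth_with_bounded_derivatives f \<longleftrightarrow>
     (\<exists>D. iterated_derivatives UNIV f D \<and>
       (\<forall>k. \<exists>K. \<forall>x vs. length vs = k \<longrightarrow> norm (D x vs) \<le> K * (\<Prod>v\<leftarrow>vs. norm v)))"

definition exact_flow ::
    "('a::real_normed_vector \<Rightarrow> 'a) \<Rightarrow> (real \<Rightarrow> 'a \<Rightarrow> 'a) \<Rightarrow> bool" where
  "exact_flow F E \<longleftrightarrow>
     (\<forall>u. E 0 u = u) \<and>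
     (\<forall>t u. ((\<lambda>\<tau>. E \<tau> u) has_vector_derivative F (E t u)) (at t))"

definition scheme_flow :: "real \<Rightarrow> (real \<Rightarrow> 'a::real_normed_vector \<Rightarrow> 'a) \<Rightarrow> bool" where
  "scheme_flow T S \<longleftrightarrow>
     smooth_on ({-T<..<T} \<times> UNIV) (\<lambda>(t, u). S t u) \<and> (\<forall>u. S 0 u = u)"

definition local_error ::
    "(real \<Rightarrow> 'a::real_normed_vector \<Rightarrow> 'a) \<Rightarrow> (real \<Rightarrow> 'a \<Rightarrow> 'a) \<Rightarrow> real \<Rightarrow> 'a \<Rightarrow> 'a" where
  "local_error S E t u = S t u - E t u"

definition has_order ::
    "(real \<Rightarrow> 'a::real_normed_vector \<Rightarrow> 'a) \<Rightarrow> (real \<Rightarrow> 'a \<Rightarrow> 'a) \<Rightarrow> nat \<Rightarrow> bool" where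
  "has_order S E p \<longleftrightarrow>
     (\<forall>u. (\<lambda>t. norm (local_error S E t u)) \<in> O[at 0](\<lambda>t. t ^ (p + 1)))"

definition partial1 ::
    "(real \<Rightarrow> 'a::real_normed_vector \<Rightarrow> 'a) \<Rightarrow> real \<Rightarrow> 'a \<Rightarrow> 'a" where
  "partial1 G t u = vector_derivative (\<lambda>\<tau>. G \<tau> u) (at t)"

definition partial2 ::
    "(real \<Rightarrow> 'a::real_normed_vector \<Rightarrow> 'a) \<Rightarrow> real \<Rightarrow> 'a \<Rightarrow> 'a \<Rightarrow> 'a" where
  "partial2 G t u = frechet_derivative (\<lambda>w. G t w) (at u)"

definition symmetrized_defect ::
    "('a::real_normed_vector \<Rightarrow> 'a) \<Rightarrow> (real \<Rightarrow> 'a \<Rightarrow> 'a) \<Rightarrow> real \<Rightarrow> 'a \<Rightarrow> 'a" where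
  "symmetrized_defect F S t u =
     partial1 S t u - (1/2) *\<^sub>R (F (S t u) + partial2 S t u (F u))"

text \<open>
  This is the Henstock-Kurzweil integral because the Bochner integral of the library is restricted
  to second-countable target spaces. \<open>integral {a..b} f\<close> is 0 for \<open>b < a\<close>, hence the orientation.
\<close>

definition oriented_integral :: "real \<Rightarrow> real \<Rightarrow> (real \<Rightarrow> 'a::real_normed_vector) \<Rightarrow> 'a" where
  "oriented_integral a b f = (if a \<le> b then integral {a..b} f else - integral {b..a} f)"

end

theory Submission
  imports Defs
begin

text \<open>
  Split the time \<open>t\<close> into a scheme step of length \<open>s\<close> between two exact steps of length
  \<open>r s = (t - s) / 2\<close>, and let \<open>\<Phi> s = E (r s) (S s (E (r s) u0))\<close>. At \<open>s = 0\<close> only the two exact steps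
  remain, so \<open>\<Phi> 0 = E t u0\<close> by the group property; at \<open>s = t\<close> only the scheme step remains, so
  \<open>\<Phi> t = S t u0\<close>. The local error is therefore \<open>\<Phi> t - \<Phi> 0\<close>, and everything reduces to showing that
  the integrand is the derivative of \<open>\<Phi>\<close>. Every derivative is gauge integrable, with the
  increment of \<open>\<Phi>\<close> as its integral, which gives both integrability and the identity.

  Put \<open>v = E (r s) u0\<close> and \<open>w = S s v\<close>. The inner curve \<open>S s (E (r s) u0)\<close> has derivative
  \<open>partial1 S s v - partial2 S s v (F v) / 2\<close> (\<open>scheme_along_curve\<close>). The outer exact step is
  taken at a varying time and a varying point, but
  \<open>E (r \<sigma>) x = E (r s) (E (r \<sigma> - r s) x)\<close> moves the variation in time to time \<open>0\<close>, where the
  joint derivative of the flow is \<open>(h, k) \<mapsto> h F w + k\<close>. The change of the outer time thus adds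
  \<open>- F w / 2\<close> to the derivative of the inner curve, which completes the symmetrized defect, and
  \<open>partial2 E (r s) w\<close> is applied to the sum (\<open>E_along_curve\<close>).

  The analytic core is that \<open>E t\<close> is Frechet differentiable in the initial value
  (\<open>E_differentiable\<close>). It is proved without solving the variational equation: for small \<open>t\<close> a Gronwall estimate shows that the increment
  \<open>h \<mapsto> E t (w + h) - E t w\<close> is linear up to a quadratic error, and in a Banach space such a map
  has a bounded linear part, obtained by rescaling (\<open>almost_linear_imp_approx_linear\<close>). Longer
  times follow by composing short steps.
\<close>

section \<open>Derivatives of smooth maps\<close>

lemma iterated_derivatives_linear:
  assumes "iterated_derivatives U f D" "x \<in> U"
  shows "bounded_linear (\<lambda>h. D x (h # vs))"
proof -
  define k where "k = Suc (length vs)"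
  have "bounded_multilinear k (D x)"
    using assms by (auto simp: iterated_derivatives_def)
  then obtain B where lin: "linear (\<lambda>h. D x ((0 # vs)[0 := h]))"
    and B: "\<And>us. length us = k \<Longrightarrow> norm (D x us) \<le> B * (\<Prod>v\<leftarrow>us. norm v)"
    unfolding bounded_multilinear_def k_def by (metis length_Cons zero_less_Suc)
  have "norm (D x (h # vs)) \<le> norm h * (B * (\<Prod>v\<leftarrow>vs. norm v))" for h
    using B[of "h # vs"] by (simp add: k_def mult_ac)
  with lin show ?thesis
    by (auto simp: bounded_linear_def bounded_linear_axioms_def)
qed

text \<open>
  The uniform bound over all argument lists, weighted by the product of their norms, becomes a
  Frechet derivative once the list is fixed and that product is absorbed into \<open>e\<close>.
\<close>

lemma iterated_derivatives_has_derivative: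
  assumes D: "iterated_derivatives U f D" "x \<in> U"
  shows "((\<lambda>y. D y vs) has_derivative (\<lambda>h. D x (h # vs))) (at x)"
  unfolding has_derivative_at_alt
proof (intro conjI allI impI iterated_derivatives_linear[OF D])
  fix e :: real assume "e > 0"
  define P where "P = (\<Prod>v\<leftarrow>vs. norm v)"
  have P: "P \<ge> 0"
    by (auto simp: P_def intro!: prod_list_nonneg)
  \<comment> \<open>\<open>P\<close> vanishes when some argument is 0, hence the shift by 1.\<close>
  define e' where "e' = e / (P + 1)"
  have "e' > 0"
    using \<open>e > 0\<close> P by (simp add: e'_def)
  with D have "\<forall>\<^sub>F y in at x. \<forall>us. length us = length vs \<longrightarrow>
      norm (D y us - D x us - D x ((y - x) # us)) \<le> e' * norm (y - x) * (\<Prod>v\<leftarrow>us. norm v)"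
    unfolding iterated_derivatives_def by blast
  hence "\<forall>\<^sub>F y in at x. norm (D y vs - D x vs - D x ((y - x) # vs)) \<le> e' * norm (y - x) * P"
    unfolding P_def by (rule eventually_mono) blast
  then obtain d where d: "d > 0"
    "\<And>y. y \<noteq> x \<Longrightarrow> dist y x < d \<Longrightarrow>
       norm (D y vs - D x vs - D x ((y - x) # vs)) \<le> e' * norm (y - x) * P"
    by (auto simp: eventually_at)
  have "norm (D y vs - D x vs - D x ((y - x) # vs)) \<le> e * norm (y - x)" if "norm (y - x) < d" for y
  proof (cases "y = x")
    case True
    interpret bounded_linear "\<lambda>h. D x (h # vs)"
      by (rule iterated_derivatives_linear[OF D])
    show ?thesis using True zero by simp
  next
    case False
    have "e' * P \<le> e' * (P + 1)"
      using \<open>e' > 0\<close> by simp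
    also have "\<dots> = e"
      using P by (simp add: e'_def)
    finally have "(e' * P) * norm (y - x) \<le> e * norm (y - x)"
      by (intro mult_right_mono) auto
    with d(2)[OF False] that show ?thesis
      by (simp add: dist_norm mult_ac)
  qed
  with d(1) show "\<exists>d>0. \<forall>y. norm (y - x) < d \<longrightarrow>
      norm (D y vs - D x vs - D x ((y - x) # vs)) \<le> e * norm (y - x)"
    by blast
qed

lemma has_derivative_if_quadratic_remainder:
  assumes "bounded_linear A"
    and rem: "\<And>h. norm (f (x + h) - f x - A h) \<le> C * (norm h)\<^sup>2"
  shows "(f has_derivative A) (at x)"
  unfolding has_derivative_at_alt
proof (intro conjI allI impI assms(1))
  fix e :: real assume "e > 0"
  have "norm (f y - f x - A (y - x)) \<le> e * norm (y - x)"
    if y: "norm (y - x) < e / (\<bar>C\<bar> + 1)" for y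
  proof -
    have "norm (f y - f x - A (y - x)) \<le> C * (norm (y - x))\<^sup>2"
      using rem[of "y - x"] by simp
    also have "\<dots> \<le> ((\<bar>C\<bar> + 1) * norm (y - x)) * norm (y - x)"
      unfolding power2_eq_square mult.assoc by (intro mult_right_mono) auto
    also have "\<dots> \<le> e * norm (y - x)"
      using y by (intro mult_right_mono) (auto simp: field_simps)
    finally show ?thesis .
  qed
  moreover have "e / (\<bar>C\<bar> + 1) > 0"
    using \<open>e > 0\<close> by simp
  ultimately show "\<exists>d>0. \<forall>y. norm (y - x) < d \<longrightarrow> norm (f y - f x - A (y - x)) \<le> e * norm (y - x)"
    by blast
qed

section \<open>Almost linear maps\<close>

text \<open>
  A quadratic defect is negligible compared with the scale of the argument, so zooming in at \<open>0\<close>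
  removes it: the rescaled maps \<open>2 ^ n \<delta> (h / 2 ^ n)\<close> have linearity defects of order \<open>2 ^ - n\<close>.
  Their consecutive differences are of the same order, hence summable, and the limit is the linear
  part. The three squares in the defect are chosen so that it scales exactly quadratically when
  \<open>h\<close> and \<open>k\<close> are scaled together; the linear bound on \<open>\<delta>\<close> makes the limit bounded.
\<close>

lemma almost_linear_imp_approx_linear:
  fixes \<delta> :: "'a::real_normed_vector \<Rightarrow> 'b::banach"
  assumes lip: "\<And>h. norm (\<delta> h) \<le> B * norm h"
    and almost: "\<And>a b h k. norm (\<delta> (a *\<^sub>R h + b *\<^sub>R k) - a *\<^sub>R \<delta> h - b *\<^sub>R \<delta> k)
                   \<le> C * ((norm (a *\<^sub>R h + b *\<^sub>R k))\<^sup>2 + \<bar>a\<bar> * (norm h)\<^sup>2 + \<bar>b\<bar> * (norm k)\<^sup>2)"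
  obtains A C' where "bounded_linear A" "\<And>h. norm (\<delta> h - A h) \<le> C' * (norm h)\<^sup>2"
proof -
  define g where "g = (\<lambda>n h. 2 ^ n *\<^sub>R \<delta> ((1/2) ^ n *\<^sub>R h))"
  have step: "norm (g (Suc n) h - g n h) \<le> (3/2 * C * (norm h)\<^sup>2) * (1/2) ^ n" for n h
  proof -
    \<comment> \<open>Almost linearity for the combination \<open>k/2\<close> at the scale \<open>2 ^ - n\<close>.\<close>
    define k where "k = (1/2) ^ n *\<^sub>R h"
    have "g (Suc n) h - g n h = 2 ^ Suc n *\<^sub>R (\<delta> ((1/2) *\<^sub>R k + 0 *\<^sub>R k) - (1/2) *\<^sub>R \<delta> k - 0 *\<^sub>R \<delta> k)"
      by (simp add: g_def k_def algebra_simps)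
    hence "norm (g (Suc n) h - g n h)
        \<le> 2 ^ Suc n * (C * ((norm ((1/2) *\<^sub>R k + 0 *\<^sub>R k))\<^sup>2 + \<bar>1/2\<bar> * (norm k)\<^sup>2 + \<bar>0\<bar> * (norm k)\<^sup>2))"
      using almost[of "1/2" k 0 k] by (simp del: power_Suc)
    also have "\<dots> = (3/2 * C * (norm h)\<^sup>2) * (1/2) ^ n"
      by (simp add: k_def power2_eq_square power_divide field_simps)
    finally show ?thesis .
  qed
  define A where "A = (\<lambda>h. lim (\<lambda>n. g n h))"
  have sums: "summable (\<lambda>n. g (Suc n) h - g n h)" for h
    by (rule summable_comparison_test'[where N = 0, OF _ step]) (intro summable_mult summable_geometric, simp)
  have psum: "(\<Sum>i<n. g (Suc i) h - g i h) = g n h - \<delta> h" for n h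
    by (subst sum_lessThan_telescope) (simp add: g_def)
  have lim: "(\<lambda>n. g n h) \<longlonglongrightarrow> A h"
    and A_eq: "A h = \<delta> h + (\<Sum>n. g (Suc n) h - g n h)" for h
  proof -
    have "(\<lambda>n. \<delta> h + (g n h - \<delta> h)) \<longlonglongrightarrow> \<delta> h + (\<Sum>n. g (Suc n) h - g n h)"
      using summable_LIMSEQ[OF sums[of h]] unfolding psum by (intro tendsto_intros)
    hence *: "(\<lambda>n. g n h) \<longlonglongrightarrow> \<delta> h + (\<Sum>n. g (Suc n) h - g n h)"
      by simp
    from limI[OF this] show "A h = \<delta> h + (\<Sum>n. g (Suc n) h - g n h)"
      by (simp add: A_def)
    with * show "(\<lambda>n. g n h) \<longlonglongrightarrow> A h"
      by simp
  qed
  have close: "norm (\<delta> h - A h) \<le> (3 * C) * (norm h)\<^sup>2" for h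
  proof -
    have "norm (\<Sum>n. g (Suc n) h - g n h) \<le> (\<Sum>n. (3/2 * C * (norm h)\<^sup>2) * (1/2) ^ n)"
      by (intro norm_suminf_le step summable_mult summable_geometric) simp
    also have "\<dots> = (3/2 * C * (norm h)\<^sup>2) * 2"
      by (subst suminf_mult) (auto simp: suminf_geometric summable_geometric)
    finally show ?thesis by (simp add: A_eq)
  qed
  have lin: "A (a *\<^sub>R h + b *\<^sub>R k) = a *\<^sub>R A h + b *\<^sub>R A k" for a b h k
  proof -
    define Q where "Q = C * ((norm (a *\<^sub>R h + b *\<^sub>R k))\<^sup>2 + \<bar>a\<bar> * (norm h)\<^sup>2 + \<bar>b\<bar> * (norm k)\<^sup>2)"
    have bd: "norm (g n (a *\<^sub>R h + b *\<^sub>R k) - a *\<^sub>R g n h - b *\<^sub>R g n k) \<le> Q * (1/2) ^ n" for n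
    proof -
      define c :: real where "c = (1/2) ^ n"
      have c: "c > 0" "2 ^ n = 1 / c"
        by (auto simp: c_def power_divide)
      have g: "g n v = (1 / c) *\<^sub>R \<delta> (c *\<^sub>R v)" for v
        by (simp add: g_def c c_def)
      have comb: "a *\<^sub>R (c *\<^sub>R h) + b *\<^sub>R (c *\<^sub>R k) = c *\<^sub>R (a *\<^sub>R h + b *\<^sub>R k)"
        by (simp add: algebra_simps)
      have "g n (a *\<^sub>R h + b *\<^sub>R k) - a *\<^sub>R g n h - b *\<^sub>R g n k =
          (1 / c) *\<^sub>R (\<delta> (a *\<^sub>R (c *\<^sub>R h) + b *\<^sub>R (c *\<^sub>R k)) - a *\<^sub>R \<delta> (c *\<^sub>R h) - b *\<^sub>R \<delta> (c *\<^sub>R k))"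
        unfolding g comb by (simp add: algebra_simps)
      also have "norm \<dots> \<le> (1 / c) * (C * ((norm (c *\<^sub>R (a *\<^sub>R h + b *\<^sub>R k)))\<^sup>2
          + \<bar>a\<bar> * (norm (c *\<^sub>R h))\<^sup>2 + \<bar>b\<bar> * (norm (c *\<^sub>R k))\<^sup>2))"
        using almost[of a "c *\<^sub>R h" b "c *\<^sub>R k"] c(1) unfolding comb norm_scaleR
        by (simp add: divide_right_mono)
      also have "\<dots> = Q * c"
        using c(1) unfolding Q_def norm_scaleR by (simp add: field_simps power2_eq_square)
      finally show ?thesis by (simp add: c_def)
    qed
    have "(\<lambda>n. g n (a *\<^sub>R h + b *\<^sub>R k) - a *\<^sub>R g n h - b *\<^sub>R g n k) \<longlonglongrightarrow> 0"
    proof (rule Lim_null_comparison)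
      show "(\<lambda>n. Q * (1/2) ^ n) \<longlonglongrightarrow> 0"
        by (intro tendsto_mult_right_zero LIMSEQ_power_zero) simp
    qed (use bd in auto)
    moreover have "(\<lambda>n. g n (a *\<^sub>R h + b *\<^sub>R k) - a *\<^sub>R g n h - b *\<^sub>R g n k)
        \<longlonglongrightarrow> A (a *\<^sub>R h + b *\<^sub>R k) - a *\<^sub>R A h - b *\<^sub>R A k"
      by (intro tendsto_intros lim)
    ultimately have "A (a *\<^sub>R h + b *\<^sub>R k) - a *\<^sub>R A h - b *\<^sub>R A k = 0"
      by (rule LIMSEQ_unique[symmetric])
    thus ?thesis by (simp add: algebra_simps)
  qed
  have g_bound: "norm (g n h) \<le> B * norm h" for n h
  proof -
    have "norm (g n h) \<le> 2 ^ n * (B * norm ((1/2) ^ n *\<^sub>R h))"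
      unfolding g_def norm_scaleR[of "2 ^ n"] by (intro mult_mono lip) auto
    thus ?thesis by (simp add: power_divide)
  qed
  have "norm (A h) \<le> norm h * B" for h
    by (rule Lim_norm_ubound[OF _ lim]) (use g_bound in \<open>auto simp: mult.commute\<close>)
  moreover have "linear A"
    using lin[of 1 _ 1] lin[of _ _ 0 0] by (intro linearI) auto
  ultimately have "bounded_linear A"
    by (auto simp: bounded_linear_def bounded_linear_axioms_def)
  with close show ?thesis by (intro that)
qed

section \<open>Differential inequalities on short time intervals\<close>

text \<open>
  On an interval so short that \<open>L * \<tau> \<le> 1/2\<close>, the mean value inequality at a maximum point of
  \<open>norm (y s)\<close> bounds the maximum by \<open>norm (y 0)\<close> plus half of itself, which can be absorbed on
  the left. Short intervals suffice below, because the flow at any time is a composition of flows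
  at short times.
\<close>

lemma short_time_gronwall:
  fixes y :: "real \<Rightarrow> 'a::real_normed_vector"
  assumes deriv: "\<And>s. \<bar>s\<bar> \<le> \<tau> \<Longrightarrow> (y has_vector_derivative y' s) (at s)"
    and bound: "\<And>s. \<bar>s\<bar> \<le> \<tau> \<Longrightarrow> norm (y' s) \<le> L * norm (y s) + e"
    and "L \<ge> 0" "L * \<tau> \<le> 1/2" and t: "\<bar>t\<bar> \<le> \<tau>"
  shows "norm (y t) \<le> 2 * norm (y 0) + 2 * \<tau> * e"
proof -
  have \<tau>: "\<tau> \<ge> 0" using t by simp
  have "continuous_on {-\<tau>..\<tau>} y"
    by (intro continuous_at_imp_continuous_on ballI has_vector_derivative_continuous[OF deriv]) auto
  hence "continuous_on {-\<tau>..\<tau>} (\<lambda>s. norm (y s))"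
    by (intro continuous_intros)
  with \<tau> obtain m where "m \<in> {-\<tau>..\<tau>}" "\<forall>s\<in>{-\<tau>..\<tau>}. norm (y s) \<le> norm (y m)"
    using continuous_attains_sup[of "{-\<tau>..\<tau>}" "\<lambda>s. norm (y s)"] by auto
  hence m: "\<bar>m\<bar> \<le> \<tau>" and max: "\<And>s. \<bar>s\<bar> \<le> \<tau> \<Longrightarrow> norm (y s) \<le> norm (y m)"
    by (auto simp: abs_le_iff)
  define M where "M = norm (y m)"
  have le: "norm (y' s) \<le> L * M + e" if "\<bar>s\<bar> \<le> \<tau>" for s
    using bound[OF that] mult_left_mono[OF max[OF that] \<open>L \<ge> 0\<close>] by (simp add: M_def)
  have "norm (y m - y 0) \<le> (L * M + e) * norm (m - 0)"
  proof (rule differentiable_bound[where S = "{-\<tau>..\<tau>}" and f' = "\<lambda>s h. h *\<^sub>R y' s"])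
    show "(y has_derivative (\<lambda>h. h *\<^sub>R y' s)) (at s within {-\<tau>..\<tau>})" if "s \<in> {-\<tau>..\<tau>}" for s
      using deriv[of s] that by (auto simp: has_vector_derivative_def intro: has_derivative_at_withinI)
    show "onorm (\<lambda>h::real. h *\<^sub>R y' s) \<le> L * M + e" if "s \<in> {-\<tau>..\<tau>}" for s
      using le[of s] that by (intro onorm_le) (auto simp: mult.commute[of "\<bar>_\<bar>"] intro!: mult_right_mono)
  qed (use m \<tau> in auto)
  also have "\<dots> \<le> (L * M + e) * \<tau>"
    using m le[OF m] by (intro mult_left_mono) (auto intro: order_trans[OF norm_ge_zero])
  also have "\<dots> = (L * \<tau>) * M + \<tau> * e"
    by (simp add: algebra_simps)
  also have "\<dots> \<le> 1/2 * M + \<tau> * e"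
    using assms(4) by (intro add_right_mono mult_right_mono) (auto simp: M_def)
  finally have "M \<le> norm (y 0) + (1/2 * M + \<tau> * e)"
    using norm_triangle_sub[of "y m" "y 0"] by (simp add: M_def)
  with max[OF t] show ?thesis by (simp add: M_def)
qed

section \<open>The flow of a vector field with bounded, Lipschitz derivative\<close>

locale regular_flow =
  fixes F :: "'a::banach \<Rightarrow> 'a" and E :: "real \<Rightarrow> 'a \<Rightarrow> 'a"
    and DF :: "'a \<Rightarrow> 'a \<Rightarrow> 'a" and M L K :: real
  assumes flow: "exact_flow F E"
    and F_bound: "norm (F x) \<le> M"
    and F_deriv: "(F has_derivative DF x) (at x)"
    and DF_bound: "norm (DF x h) \<le> L * norm h"
    and DF_lipschitz: "norm (DF y h - DF x h) \<le> K * norm (y - x) * norm h"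
    and L_nonneg: "L \<ge> 0" and K_nonneg: "K \<ge> 0"
begin

lemma E_0 [simp]: "E 0 u = u"
  using flow by (simp add: exact_flow_def)

lemma E_deriv: "((\<lambda>s. E s u) has_vector_derivative F (E t u)) (at t)"
  using flow by (simp add: exact_flow_def)

lemma F_lipschitz: "norm (F y - F x) \<le> L * norm (y - x)"
proof (rule differentiable_bound[where S = UNIV and f' = DF])
  show "onorm (DF x) \<le> L" for x
    by (rule onorm_bound[OF L_nonneg DF_bound])
qed (auto intro: F_deriv)

text \<open>
  Subtracting the linear map \<open>DF x\<close> leaves a map whose derivative is at most
  \<open>K * norm (y - x)\<close> on the ball around \<open>x\<close> through \<open>y\<close>; the mean value inequality there gives the
  quadratic bound.
\<close>

lemma F_taylor: "norm (F y - F x - DF x (y - x)) \<le> K * (norm (y - x))\<^sup>2"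
proof -
  have lin: "bounded_linear (DF z)" for z
    using F_deriv by (rule has_derivative_bounded_linear)
  have "norm ((F y - DF x y) - (F x - DF x x)) \<le> (K * norm (y - x)) * norm (y - x)"
  proof (rule differentiable_bound[where S = "cball x (norm (y - x))" and f' = "\<lambda>z h. DF z h - DF x h"])
    fix z assume z: "z \<in> cball x (norm (y - x))"
    show "((\<lambda>z. F z - DF x z) has_derivative (\<lambda>h. DF z h - DF x h)) (at z within cball x (norm (y - x)))"
      by (rule has_derivative_at_withinI)
        (intro has_derivative_diff F_deriv bounded_linear_imp_has_derivative lin)
    have "norm (DF z h - DF x h) \<le> K * norm (y - x) * norm h" for h
      using z by (intro order_trans[OF DF_lipschitz] mult_right_mono mult_left_mono)
        (auto simp: K_nonneg dist_norm norm_minus_commute)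
    thus "onorm (\<lambda>h. DF z h - DF x h) \<le> K * norm (y - x)"
      by (intro onorm_bound) (auto simp: K_nonneg)
  qed (auto simp: dist_norm norm_minus_commute)
  moreover have "(F y - DF x y) - (F x - DF x x) = F y - F x - DF x (y - x)"
    unfolding linear_diff[OF bounded_linear.linear[OF lin]] by (simp add: algebra_simps)
  ultimately show ?thesis by (simp add: power2_eq_square mult.assoc)
qed

text \<open>
  The length of a short step. The shift by 1 keeps it finite and positive when \<open>L = 0\<close>.
\<close>

definition \<tau> :: real where "\<tau> = 1 / (2 * (L + 1))"

lemma \<tau>_pos: "\<tau> > 0" and L_\<tau>: "L * \<tau> \<le> 1/2"
  using L_nonneg by (auto simp: \<tau>_def field_simps)

text \<open>
  Both sides solve the differential equation in \<open>t\<close> with the value \<open>E s u\<close> at \<open>t = 0\<close>, and the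
  Gronwall estimate makes such a solution unique.
\<close>

lemma E_add_short:
  assumes "\<bar>t\<bar> \<le> \<tau>"
  shows "E (t + s) u = E t (E s u)"
proof -
  define y where "y = (\<lambda>r. E (r + s) u - E r (E s u))"
  have "norm (y t) \<le> 2 * norm (y 0) + 2 * \<tau> * 0"
  proof (rule short_time_gronwall[OF _ _ L_nonneg L_\<tau> assms])
    fix r
    have "((\<lambda>r. r + s) has_vector_derivative 1) (at r)"
      by (auto intro!: derivative_eq_intros)
    from vector_diff_chain_at[OF this E_deriv]
    have "((\<lambda>r. E (r + s) u) has_vector_derivative F (E (r + s) u)) (at r)"
      by (simp add: o_def)
    thus "(y has_vector_derivative F (E (r + s) u) - F (E r (E s u))) (at r)"
      unfolding y_def by (intro has_vector_derivative_diff E_deriv)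
    show "norm (F (E (r + s) u) - F (E r (E s u))) \<le> L * norm (y r) + 0"
      using F_lipschitz by (simp add: y_def)
  qed
  thus ?thesis by (simp add: y_def)
qed

lemma short_steps:
  obtains n s where "t = real n * s" "\<bar>s\<bar> \<le> \<tau>"
proof -
  obtain n where n: "\<bar>t\<bar> / \<tau> < real n"
    using reals_Archimedean2 by blast
  moreover have "\<bar>t\<bar> / \<tau> \<ge> 0" using \<tau>_pos by simp
  ultimately have "real n > 0" by linarith
  with n \<tau>_pos show ?thesis
    by (intro that[of n "t / real n"]) (auto simp: field_simps)
qed

lemma E_add: "E (t + s) u = E t (E s u)"
proof -
  obtain n r where t: "t = real n * r" and r: "\<bar>r\<bar> \<le> \<tau>"
    by (rule short_steps)
  have "E (real n * r + s) u = E (real n * r) (E s u)"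
  proof (induction n)
    case (Suc n)
    have "E (real (Suc n) * r + s) u = E r (E (real n * r + s) u)"
      using E_add_short[OF r, of "real n * r + s" u] by (simp add: algebra_simps)
    also have "\<dots> = E (real (Suc n) * r) (E s u)"
      using E_add_short[OF r, of "real n * r" "E s u"] Suc by (simp add: algebra_simps)
    finally show ?case .
  qed simp
  thus ?thesis by (simp add: t)
qed

text \<open>
  The increments \<open>\<delta> h\<close> of the flow satisfy the linear variational equation up to the Taylor
  remainder \<open>R h\<close> of \<open>F\<close>, which is quadratic in \<open>h\<close>. The linearity defect \<open>\<rho>\<close> of \<open>\<delta>\<close> starts at \<open>0\<close> and
  satisfies the same equation up to three such remainders, so by Gronwall it stays quadratically
  small.
\<close>

lemma E_differentiable_short:
  assumes t: "\<bar>t\<bar> \<le> \<tau>"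
  shows "(\<lambda>u. E t u) differentiable (at w)"
proof -
  define \<delta> where "\<delta> = (\<lambda>h s. E s (w + h) - E s w)"
  have \<delta>_deriv: "(\<delta> h has_vector_derivative F (E s (w + h)) - F (E s w)) (at s)" for h s
    unfolding \<delta>_def by (intro has_vector_derivative_diff E_deriv)
  have \<delta>_bound: "norm (\<delta> h s) \<le> 2 * norm h" if "\<bar>s\<bar> \<le> \<tau>" for h s
  proof -
    have "norm (\<delta> h s) \<le> 2 * norm (\<delta> h 0) + 2 * \<tau> * 0"
      by (rule short_time_gronwall[OF \<delta>_deriv _ L_nonneg L_\<tau> that]) (simp add: \<delta>_def F_lipschitz)
    thus ?thesis by (simp add: \<delta>_def)
  qed
  define R where "R = (\<lambda>h s. F (E s (w + h)) - F (E s w) - DF (E s w) (\<delta> h s))"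
  have R_bound: "norm (R h s) \<le> 4 * K * (norm h)\<^sup>2" if "\<bar>s\<bar> \<le> \<tau>" for h s
  proof -
    have "norm (R h s) \<le> K * (norm (\<delta> h s))\<^sup>2"
      unfolding R_def \<delta>_def by (rule F_taylor)
    also have "\<dots> \<le> K * (2 * norm h)\<^sup>2"
      by (intro mult_left_mono power_mono \<delta>_bound that K_nonneg) auto
    finally show ?thesis by (simp add: power2_eq_square algebra_simps)
  qed
  have almost: "norm (\<delta> (a *\<^sub>R h + b *\<^sub>R k) t - a *\<^sub>R \<delta> h t - b *\<^sub>R \<delta> k t)
      \<le> (8 * \<tau> * K) * ((norm (a *\<^sub>R h + b *\<^sub>R k))\<^sup>2 + \<bar>a\<bar> * (norm h)\<^sup>2 + \<bar>b\<bar> * (norm k)\<^sup>2)" for a b h k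
  proof -
    define c where "c = a *\<^sub>R h + b *\<^sub>R k"
    define e where "e = 4 * K * ((norm c)\<^sup>2 + \<bar>a\<bar> * (norm h)\<^sup>2 + \<bar>b\<bar> * (norm k)\<^sup>2)"
    define \<rho> where "\<rho> = (\<lambda>s. \<delta> c s - a *\<^sub>R \<delta> h s - b *\<^sub>R \<delta> k s)"
    have "norm (\<rho> t) \<le> 2 * norm (\<rho> 0) + 2 * \<tau> * e"
    proof (rule short_time_gronwall[OF _ _ L_nonneg L_\<tau> t])
      fix s assume s: "\<bar>s\<bar> \<le> \<tau>"
      let ?d = "\<lambda>h. F (E s (w + h)) - F (E s w)"
      show "(\<rho> has_vector_derivative ?d c - a *\<^sub>R ?d h - b *\<^sub>R ?d k) (at s)"
        unfolding \<rho>_def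
        by (intro has_vector_derivative_diff \<delta>_deriv
              bounded_linear.has_vector_derivative[OF bounded_linear_scaleR_right])
      have lin: "linear (DF (E s w))"
        using F_deriv by (rule has_derivative_linear)
      have "?d c - a *\<^sub>R ?d h - b *\<^sub>R ?d k
          = DF (E s w) (\<rho> s) + (R c s - a *\<^sub>R R h s - b *\<^sub>R R k s)"
        unfolding R_def \<rho>_def linear_diff[OF lin] linear_scale[OF lin] by (simp add: algebra_simps)
      also have "norm \<dots> \<le> norm (DF (E s w) (\<rho> s)) + (norm (R c s) + norm (a *\<^sub>R R h s) + norm (b *\<^sub>R R k s))"
        by (intro norm_triangle_le add_left_mono order_trans[OF norm_triangle_ineq4] add_right_mono) auto
      also have "\<dots> \<le> L * norm (\<rho> s) + (4 * K * (norm c)\<^sup>2 + \<bar>a\<bar> * (4 * K * (norm h)\<^sup>2) + \<bar>b\<bar> * (4 * K * (norm k)\<^sup>2))"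
        unfolding norm_scaleR by (intro add_mono DF_bound R_bound s mult_left_mono) auto
      also have "\<dots> = L * norm (\<rho> s) + e"
        by (simp add: e_def algebra_simps)
      finally show "norm (?d c - a *\<^sub>R ?d h - b *\<^sub>R ?d k) \<le> L * norm (\<rho> s) + e" .
    qed
    moreover have "\<rho> 0 = 0"
      by (simp add: \<rho>_def \<delta>_def c_def)
    ultimately show ?thesis
      by (simp add: \<rho>_def e_def c_def algebra_simps)
  qed
  obtain A C where "bounded_linear A" "\<And>h. norm (\<delta> h t - A h) \<le> C * (norm h)\<^sup>2"
    using almost_linear_imp_approx_linear[of "\<lambda>h. \<delta> h t", OF \<delta>_bound[OF t] almost] by metis
  hence "((\<lambda>u. E t u) has_derivative A) (at w)"
    by (intro has_derivative_if_quadratic_remainder) (auto simp: \<delta>_def)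
  thus ?thesis by (auto simp: differentiable_def)
qed

lemma E_differentiable: "(\<lambda>u. E t u) differentiable (at w)"
proof -
  obtain n r where t: "t = real n * r" and r: "\<bar>r\<bar> \<le> \<tau>"
    by (rule short_steps)
  have "(\<lambda>u. E (real n * r) u) differentiable (at w)"
  proof (induction n)
    case (Suc n)
    have "(\<lambda>u. E (real (Suc n) * r) u) = (\<lambda>u. E r u) \<circ> (\<lambda>u. E (real n * r) u)"
      by (rule ext) (simp add: E_add[symmetric] algebra_simps)
    with Suc E_differentiable_short[OF r] show ?case
      by (metis differentiable_chain_at)
  qed simp
  thus ?thesis by (simp add: t)
qed

lemma E_deriv_initial: "((\<lambda>u. E t u) has_derivative partial2 E t w) (at w)"
  using E_differentiable[of t w] by (simp add: partial2_def frechet_derivative_works)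

lemma E_increment: "norm (E h u - u) \<le> M * \<bar>h\<bar>"
proof -
  have "norm (E h u - E 0 u) \<le> M * norm (h - 0)"
  proof (rule differentiable_bound[where S = UNIV and f' = "\<lambda>s k. k *\<^sub>R F (E s u)"])
    show "onorm (\<lambda>k::real. k *\<^sub>R F (E s u)) \<le> M" for s :: real
      using F_bound by (intro onorm_le) (auto simp: mult.commute[of "\<bar>_\<bar>"] intro!: mult_right_mono)
  qed (use E_deriv in \<open>auto simp: has_vector_derivative_def\<close>)
  thus ?thesis by simp
qed

text \<open>
  The error of the Euler step is quadratic in \<open>h\<close> uniformly in \<open>u\<close>. The uniformity is what makes
  the joint derivative below available, where the initial value varies with \<open>h\<close>.
\<close>

lemma E_euler_step: "norm (E h u - u - h *\<^sub>R F u) \<le> L * M * h\<^sup>2"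
proof -
  let ?S = "cball (0::real) \<bar>h\<bar>"
  have M: "M \<ge> 0" using F_bound[of 0] norm_ge_zero order_trans by blast
  have "norm ((E h u - h *\<^sub>R F u) - (E 0 u - 0 *\<^sub>R F u)) \<le> (L * (M * \<bar>h\<bar>)) * norm (h - 0)"
  proof (rule differentiable_bound[where S = ?S and f' = "\<lambda>s k. k *\<^sub>R (F (E s u) - F u)"])
    fix s assume s: "s \<in> ?S"
    have "((\<lambda>s. E s u - s *\<^sub>R F u) has_vector_derivative F (E s u) - 1 *\<^sub>R F u) (at s)"
      by (intro has_vector_derivative_diff E_deriv) (auto intro!: derivative_eq_intros)
    thus "((\<lambda>s. E s u - s *\<^sub>R F u) has_derivative (\<lambda>k. k *\<^sub>R (F (E s u) - F u))) (at s within ?S)"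
      by (auto simp: has_vector_derivative_def intro: has_derivative_at_withinI)
    have "norm (F (E s u) - F u) \<le> L * (M * \<bar>s\<bar>)"
      by (intro order_trans[OF F_lipschitz] mult_left_mono E_increment L_nonneg)
    also have "\<dots> \<le> L * (M * \<bar>h\<bar>)"
      using s M L_nonneg by (intro mult_left_mono) auto
    finally show "onorm (\<lambda>k::real. k *\<^sub>R (F (E s u) - F u)) \<le> L * (M * \<bar>h\<bar>)"
      by (intro onorm_le) (auto simp: mult.commute[of "\<bar>_\<bar>"] intro!: mult_right_mono)
  qed auto
  thus ?thesis by (simp add: power2_eq_square algebra_simps)
qed

lemma E_deriv_joint_0: "((\<lambda>(h, u). E h u) has_derivative (\<lambda>(h, k). h *\<^sub>R F w + k)) (at (0, w))"
proof (rule has_derivative_if_quadratic_remainder)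
  show "bounded_linear (\<lambda>(h, k). h *\<^sub>R F w + k)"
    unfolding case_prod_beta
    by (intro bounded_linear_intros bounded_linear_fst bounded_linear_snd)
  fix z :: "real \<times> 'a"
  obtain h k where z: "z = (h, k)" by force
  have hk: "\<bar>h\<bar> \<le> norm z" "norm k \<le> norm z"
    using norm_fst_le[of h k] norm_snd_le[of k h] by (auto simp: z)
  have M: "M \<ge> 0" using F_bound[of 0] norm_ge_zero order_trans by blast
  have "E h (w + k) - w - (h *\<^sub>R F w + k)
      = (E h (w + k) - (w + k) - h *\<^sub>R F (w + k)) + h *\<^sub>R (F (w + k) - F w)"
    by (simp add: algebra_simps)
  also have "norm \<dots> \<le> L * M * h\<^sup>2 + \<bar>h\<bar> * (L * norm k)"
    using F_lipschitz[of "w + k" w]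
    by (intro norm_triangle_le add_mono E_euler_step) (auto intro!: mult_left_mono)
  also have "\<dots> \<le> L * M * (norm z)\<^sup>2 + norm z * (L * norm z)"
    using hk L_nonneg M by (intro add_mono mult_left_mono mult_mono) (auto simp: abs_le_square_iff[symmetric])
  also have "\<dots> = (L * M + L) * (norm z)\<^sup>2"
    by (simp add: power2_eq_square algebra_simps)
  finally show "norm ((case (0, w) + z of (h, u) \<Rightarrow> E h u) - (case (0, w) of (h, u) \<Rightarrow> E h u)
      - (case z of (h, k) \<Rightarrow> h *\<^sub>R F w + k)) \<le> (L * M + L) * (norm z)\<^sup>2"
    by (simp add: z)
qed

text \<open>
  The group property writes the curve as the fixed map \<open>E (r s)\<close> after a flow over the time
  \<open>r \<sigma> - r s\<close>, which vanishes at \<open>\<sigma> = s\<close>. Hence only the derivative of \<open>E (r s)\<close> in the initial value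
  and the joint derivative at time \<open>0\<close> are needed, instead of a joint derivative at every time.
\<close>

lemma E_along_curve:
  assumes r: "(r has_vector_derivative r') (at s)" and w: "(w has_vector_derivative w') (at s)"
  shows "((\<lambda>\<sigma>. E (r \<sigma>) (w \<sigma>)) has_vector_derivative
           partial2 E (r s) (w s) (r' *\<^sub>R F (w s) + w')) (at s)"
proof -
  define \<gamma> where "\<gamma> = (\<lambda>\<sigma>. (r \<sigma> - r s, w \<sigma>))"
  have "(\<gamma> has_vector_derivative (r' - 0, w')) (at s)"
    unfolding \<gamma>_def by (intro has_vector_derivative_Pair has_vector_derivative_diff r w has_vector_derivative_const)
  hence "(((\<lambda>(h, u). E h u) \<circ> \<gamma>) has_vector_derivative (\<lambda>(h, k). h *\<^sub>R F (w s) + k) (r' - 0, w')) (at s)"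
    using E_deriv_joint_0[of "w s"]
    by (intro vector_derivative_diff_chain_within)
      (auto simp: \<gamma>_def intro: has_derivative_at_withinI)
  hence "((\<lambda>\<sigma>. E (r \<sigma> - r s) (w \<sigma>)) has_vector_derivative r' *\<^sub>R F (w s) + w') (at s)"
    by (simp add: \<gamma>_def o_def)
  hence "(E (r s) \<circ> (\<lambda>\<sigma>. E (r \<sigma> - r s) (w \<sigma>)) has_vector_derivative
           partial2 E (r s) (w s) (r' *\<^sub>R F (w s) + w')) (at s)"
    using E_deriv_initial[of "r s" "w s"]
    by (intro vector_derivative_diff_chain_within) (auto intro: has_derivative_at_withinI)
  moreover have "E (r s) \<circ> (\<lambda>\<sigma>. E (r \<sigma> - r s) (w \<sigma>)) = (\<lambda>\<sigma>. E (r \<sigma>) (w \<sigma>))"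
    by (rule ext) (simp add: E_add[symmetric])
  ultimately show ?thesis by simp
qed

end

text \<open>
  The bounds on \<open>F\<close> and its first two derivatives give the constants: the bound on the second
  derivative makes the first one Lipschitz.
\<close>

lemma smooth_bounded_flow_regular:
  fixes F :: "'a::banach \<Rightarrow> 'a"
  assumes "smooth_with_bounded_derivatives F" and flow: "exact_flow F E"
  obtains DF M L K where "regular_flow F E DF M L K"
proof -
  obtain D where D: "iterated_derivatives UNIV F D"
    and bd: "\<And>k. \<exists>K. \<forall>x vs. length vs = k \<longrightarrow> norm (D x vs) \<le> K * (\<Prod>v\<leftarrow>vs. norm v)"
    using assms(1) by (auto simp: smooth_with_bounded_derivatives_def)
  obtain M L K where "\<And>x vs. length vs = 0 \<Longrightarrow> norm (D x vs) \<le> M * (\<Prod>v\<leftarrow>vs. norm v)"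
    "\<And>x vs. length vs = 1 \<Longrightarrow> norm (D x vs) \<le> L * (\<Prod>v\<leftarrow>vs. norm v)"
    "\<And>x vs. length vs = 2 \<Longrightarrow> norm (D x vs) \<le> K * (\<Prod>v\<leftarrow>vs. norm v)"
    using bd[of 0] bd[of 1] bd[of 2] by auto
  from this(1)[of "[]"] this(2)[of "[_]"] this(3)[of "[_, _]"]
  have M: "norm (D x []) \<le> M" and L: "norm (D x [h]) \<le> L * norm h"
    and K: "norm (D x [h, k]) \<le> K * (norm h * norm k)" for x h k
    by (auto simp: numeral_2_eq_2)
  have F: "D x [] = F x" for x
    using D by (simp add: iterated_derivatives_def)
  have L': "norm (D x [h]) \<le> \<bar>L\<bar> * norm h" for x h
    by (rule order_trans[OF L]) (auto intro!: mult_right_mono)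
  have "norm (D y [h] - D x [h]) \<le> (\<bar>K\<bar> * norm h) * norm (y - x)" for x y h
  proof (rule differentiable_bound[where S = UNIV and f' = "\<lambda>z k. D z [k, h]"])
    show "((\<lambda>z. D z [h]) has_derivative (\<lambda>k. D z [k, h])) (at z)" for z
      by (rule iterated_derivatives_has_derivative[OF D]) auto
    have "norm (D z [k, h]) \<le> \<bar>K\<bar> * norm h * norm k" for z k
      by (rule order_trans[OF K]) (auto simp: mult_ac intro!: mult_left_mono mult_right_mono)
    thus "onorm (\<lambda>k. D z [k, h]) \<le> \<bar>K\<bar> * norm h" for z
      by (intro onorm_bound) auto
  qed auto
  moreover have "(F has_derivative (\<lambda>h. D x [h])) (at x)" for x
    using iterated_derivatives_has_derivative[OF D, of x "[]"] by (simp add: F)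
  ultimately have "regular_flow F E (\<lambda>x h. D x [h]) M \<bar>L\<bar> \<bar>K\<bar>"
    using M L' flow by unfold_locales (auto simp: F mult_ac)
  thus ?thesis by (rule that)
qed

section \<open>The flow of the scheme\<close>

text \<open>
  Smoothness of the scheme provides a joint derivative; restricted to the two axes it yields
  \<open>partial1\<close> and \<open>partial2\<close>, and by linearity it is their sum.
\<close>

lemma scheme_joint_derivative:
  assumes S: "scheme_flow T S" and s: "\<bar>s\<bar> < T"
  shows "((\<lambda>(t, u). S t u) has_derivative (\<lambda>(h, k). h *\<^sub>R partial1 S s v + partial2 S s v k)) (at (s, v))"
    and "linear (partial2 S s v)"
proof -
  let ?S = "\<lambda>(t, u). S t u"
  from S obtain D where D: "iterated_derivatives ({-T<..<T} \<times> UNIV) ?S D"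
    by (auto simp: scheme_flow_def smooth_on_def)
  define A where "A = (\<lambda>z. D (s, v) [z])"
  have mem: "(s, v) \<in> {-T<..<T} \<times> UNIV"
    using s by auto
  have "open ({-T<..<T} \<times> (UNIV :: 'a set))"
    by (intro open_Times) auto
  have "((\<lambda>z. D z []) has_derivative A) (at (s, v))"
    unfolding A_def by (rule iterated_derivatives_has_derivative[OF D mem])
  moreover have "D z [] = ?S z" if "z \<in> {-T<..<T} \<times> UNIV" for z
    using D that unfolding iterated_derivatives_def by blast
  ultimately have A: "(?S has_derivative A) (at (s, v))"
    using has_derivative_transform_within_open[OF _ \<open>open _\<close> mem, of "\<lambda>z. D z []" A UNIV ?S] by blast
  note lin = has_derivative_linear[OF A]
  have "((\<lambda>t. (t, v)) has_derivative (\<lambda>h. (h, 0))) (at s)"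
    by (auto intro!: derivative_eq_intros)
  from diff_chain_at[OF this A] have "((\<lambda>t. S t v) has_derivative (\<lambda>h. A (h, 0))) (at s)"
    by (simp add: o_def)
  moreover have "(\<lambda>h. A (h, 0)) = (\<lambda>h. h *\<^sub>R A (1, 0))"
  proof (rule ext)
    show "A (h, 0) = h *\<^sub>R A (1, 0)" for h
      using linear_scale[OF lin, of h "(1, 0)"] by simp
  qed
  ultimately have p1: "partial1 S s v = A (1, 0)"
    unfolding partial1_def by (metis has_vector_derivative_def vector_derivative_at)
  have "((\<lambda>w. (s, w)) has_derivative (\<lambda>h. (0, h))) (at v)"
    by (auto intro!: derivative_eq_intros)
  from diff_chain_at[OF this A] have p2': "((\<lambda>w. S s w) has_derivative (\<lambda>h. A (0, h))) (at v)"
    by (simp add: o_def)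
  from frechet_derivative_at[OF this] have p2: "partial2 S s v = (\<lambda>h. A (0, h))"
    by (simp add: partial2_def)
  from has_derivative_linear[OF p2'] show "linear (partial2 S s v)"
    by (simp add: p2)
  have "A = (\<lambda>(h, k). h *\<^sub>R partial1 S s v + partial2 S s v k)"
  proof (rule ext, clarify)
    fix h :: real and k :: 'a
    have "A (h, k) = A (h *\<^sub>R (1, 0) + (0, k))"
      by simp
    thus "A (h, k) = h *\<^sub>R partial1 S s v + partial2 S s v k"
      unfolding p1 p2 linear_add[OF lin] linear_scale[OF lin] .
  qed
  with A show "(?S has_derivative (\<lambda>(h, k). h *\<^sub>R partial1 S s v + partial2 S s v k)) (at (s, v))"
    by simp
qed

lemma scheme_along_curve:
  assumes S: "scheme_flow T S" and s: "\<bar>s\<bar> < T"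
    and v: "(v has_vector_derivative v') (at s)"
  shows "((\<lambda>\<sigma>. S \<sigma> (v \<sigma>)) has_vector_derivative
           partial1 S s (v s) + partial2 S s (v s) v') (at s)"
proof -
  have "((\<lambda>\<sigma>. (\<sigma>, v \<sigma>)) has_vector_derivative (1, v')) (at s)"
    by (intro has_vector_derivative_Pair v) (auto intro!: derivative_eq_intros)
  from vector_derivative_diff_chain_within
    [OF this has_derivative_at_withinI[OF scheme_joint_derivative(1)[OF S s]]]
  show ?thesis by (simp add: o_def)
qed

section \<open>The integral representation\<close>

theorem theorem3:
  fixes F :: "'a::banach \<Rightarrow> 'a"
    and E S :: "real \<Rightarrow> 'a \<Rightarrow> 'a"
    and T t :: real
    and p :: nat
    and u0 :: 'a
  assumes "smooth_with_bounded_derivatives F"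
    and "exact_flow F E"
    and "T > 0"
    and "scheme_flow T S"
    and "p \<ge> 1"
    and "has_order S E p"
    and "\<bar>t\<bar> < T"
  defines "integrand \<equiv> (\<lambda>s. partial2 E ((t - s) / 2) (S s (E ((t - s) / 2) u0))
                             (symmetrized_defect F S s (E ((t - s) / 2) u0)))"
  shows "integrand integrable_on closed_segment 0 t \<and>
         local_error S E t u0 = oriented_integral 0 t integrand"
proof -
  obtain DF M L K where "regular_flow F E DF M L K"
    by (rule smooth_bounded_flow_regular[OF assms(1,2)])
  then interpret regular_flow F E DF M L K .
  define r where "r = (\<lambda>s. (t - s) / 2)"
  define \<Phi> where "\<Phi> = (\<lambda>s. E (r s) (S s (E (r s) u0)))"
  have deriv: "(\<Phi> has_vector_derivative integrand s) (at s)" if s: "\<bar>s\<bar> < T" for s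
  proof -
    define v where "v = E (r s) u0"
    have r: "(r has_vector_derivative -(1/2)) (at s)"
      unfolding r_def has_real_derivative_iff_has_vector_derivative[symmetric]
      by (auto intro!: derivative_eq_intros)
    have "((\<lambda>\<sigma>. E (r \<sigma>) u0) has_vector_derivative -(1/2) *\<^sub>R F v) (at s)"
      using vector_diff_chain_at[OF r E_deriv] by (simp add: o_def v_def)
    from scheme_along_curve[OF assms(4) s this]
    have "((\<lambda>\<sigma>. S \<sigma> (E (r \<sigma>) u0)) has_vector_derivative
        partial1 S s v + partial2 S s v (-(1/2) *\<^sub>R F v)) (at s)"
      by (simp add: v_def)
    from E_along_curve[OF r this]
    have "(\<Phi> has_vector_derivative partial2 E (r s) (S s v)
        (-(1/2) *\<^sub>R F (S s v) + (partial1 S s v + partial2 S s v (-(1/2) *\<^sub>R F v)))) (at s)"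
      by (simp add: \<Phi>_def v_def)
    moreover have "linear (partial2 S s v)"
      by (rule scheme_joint_derivative(2)[OF assms(4) s])
    hence "-(1/2) *\<^sub>R F (S s v) + (partial1 S s v + partial2 S s v (-(1/2) *\<^sub>R F v))
        = symmetrized_defect F S s v"
      by (simp add: symmetrized_defect_def linear_neg linear_scale algebra_simps)
    ultimately show ?thesis
      by (simp add: integrand_def r_def v_def)
  qed
  have ftc: "(integrand has_integral \<Phi> b - \<Phi> a) {a..b}" if "a \<le> b" "-T < a" "b < T" for a b
  proof (rule fundamental_theorem_of_calculus[OF that(1)])
    fix s assume "s \<in> {a..b}"
    with that show "(\<Phi> has_vector_derivative integrand s) (at s within {a..b})"
      by (intro has_vector_derivative_at_within[OF deriv]) auto
  qed
  have "\<Phi> 0 = E t u0"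
    using assms(4) E_add[of "t / 2" "t / 2" u0] by (simp add: \<Phi>_def r_def scheme_flow_def)
  moreover have "\<Phi> t = S t u0"
    by (simp add: \<Phi>_def r_def)
  ultimately have err: "local_error S E t u0 = \<Phi> t - \<Phi> 0"
    by (simp add: local_error_def)
  show ?thesis
  proof (cases "0 \<le> t")
    case True
    with assms(7) have "(integrand has_integral \<Phi> t - \<Phi> 0) {0..t}"
      by (intro ftc) auto
    with True err show ?thesis
      by (auto simp: oriented_integral_def closed_segment_eq_real_ivl integral_unique
          intro: has_integral_integrable)
  next
    case False
    with assms(7) have "(integrand has_integral \<Phi> 0 - \<Phi> t) {t..0}"
      by (intro ftc) auto
    with False err show ?thesis
      by (auto simp: oriented_integral_def closed_segment_eq_real_ivl integral_unique
          intro: has_integral_integrable)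
  qed
qed

end
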